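(* Let $A_0=\mathrm{diag}(\lambda_1,\dots,\lambda_n)$ with pairwise distinct $\lambda_i\in\mathbb C$, let $A_1$ be an arbitrary complex $n\times n$ matrix with diagonal entries $\lambda'_1,\dots,\lambda'_n$, and let $\eta$ be admissible (so that the branch cuts $L_1,\dots,L_n$ are fixed). Consider the matrix solution $\Psi(\lambda)=[\vec\Psi_1(\lambda)|\cdots|\vec\Psi_n(\lambda)]$ of $(A_0-\lambda)\frac{d\Psi}{d\lambda}=(A_1+I)\Psi$ on $\mathcal P_\eta$. For each $k$, analytic continuation along a small anticlockwise loop around $\lambda_k$, not encircling any other $\lambda_j$, transforms $\Psi(\lambda)\mapsto\Psi(\lambda)M_k$, where $M_k=(m^{(k)}_{ij})$ is $$m^{(k)}_{jj}=1\ (j\ne k),\qquad m^{(k)}_{kk}=e^{-2\pi i\lambda'_k},\qquad m^{(k)}_{kj}=\alpha_k c_{kj}\ (j\neq k),\qquad m^{(k)}_{ij}=0\ \text{ otherwise}.$$ Equivalently, the effect of the loop is $$\vec\Psi_k\mapsto e^{-2\pi i\lambda'_k}\vec\Psi_k,\qquad \vec\Psi_j\mapsto\vec\Psi_j+\alpha_kc_{kj}\vec\Psi_k\quad(j\ne k).$$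
   Context: System (F): $(A_0-\lambda)\frac{d\Psi}{d\lambda}=(A_1+I)\Psi$. $\mathbb N=\{0,1,2,\dots\}$, $\mathbb Z_-=\{-1,-2,\dots\}$, $\vec e_k$ is the $k$-th unit column vector; $\mathrm{reg}(\lambda-\lambda_j)$ denotes any vector function analytic in a neighbourhood of $\lambda_j$. Cuts. $\eta\in\mathbb R$ is admissible if $\eta\neq\arg(\lambda_j-\lambda_k)$ mod $2\pi$ for all $j\ne k$. For admissible $\eta$, $L_k$ is the ray from $\lambda_k$ to $\infty$ in direction $\eta$, and $\mathcal P_\eta$ is the plane cut along $L_1,\dots,L_n$, with the branches $\eta-2\pi<\arg(\lambda-\lambda_k)<\eta$ used for all powers and logarithms of $\lambda-\lambda_k$. Solutions of (F) are single valued on $\mathcal P_\eta$. Solutions $\vec\Psi_k$ of (F) on $\mathcal P_\eta$, defined by their behaviour near $\lambda_k$: - if $\lambda'_k\notin\mathbb Z$: the unique solution $\vec\Psi_k=\bigl(\Gamma(\lambda'_k+1)\vec e_k+\sum_{l\ge1}\vec b_l(\lambda-\lambda_k)^l\bigr)(\lambda-\lambda_k)^{-\lambda'_k-1}$; - if $\lambda'_k=N_k\in\mathbb Z_-$: the unique solution $\vec\Psi_k=\bigl(\frac{(-1)^{N_k}}{(-N_k-1)!}\vec e_k+\sum_{l\ge1}\vec b_l(\lambda-\lambda_k)^l\bigr)(\lambda-\lambda_k)^{-N_k-1}$; - if $\lambda'_k=N_k\in\mathbb N$: the unique solution $\vec\Psi_k$, analytic at $\lambda_k$ (possibly $\equiv0$),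 such that (F) has a solution of the form $\vec\Psi_k\ln(\lambda-\lambda_k)+\frac{P^{(k)}_{N_k}(\lambda)}{(\lambda-\lambda_k)^{N_k+1}}+\mathrm{reg}(\lambda-\lambda_k)$, where $P^{(k)}_{N_k}$ is a vector polynomial in $\lambda-\lambda_k$ of degree at most $N_k$ with $P^{(k)}_{N_k}(\lambda_k)=N_k!\,\vec e_k$. Singular solutions: $\vec\Psi_k^{(sing)}=\vec\Psi_k$ if $\lambda'_k\notin\mathbb Z$; if $\lambda'_k\in\mathbb N$, $\vec\Psi_k^{(sing)}$ is the solution of the form just displayed; if $\lambda'_k\in\mathbb Z_-$, $\vec\Psi_k^{(sing)}$ is a solution of the form $\vec\Psi_k\ln(\lambda-\lambda_k)+\mathrm{reg}(\lambda-\lambda_k)$ if one exists, and $\vec\Psi_k^{(sing)}\equiv0$ otherwise (then all solutions are analytic at $\lambda_k$). For $\lambda'_k\in\mathbb Z$ it is determined modulo solutions analytic at $\lambda_k$. Connection coefficients $c_{jk}$ ($1\le j,k\le n$) are the unique numbers with $\vec\Psi_k(\lambda)=\vec\Psi_j^{(sing)}(\lambda)\,c_{jk}+\mathrm{reg}(\lambda-\lambda_j)$ near $\lambda_j$ in $\mathcal P_\eta$, with $c_{jk}:=0$ for all $k$ if $\vec\Psi_j^{(sing)}\equiv0$. Put $\alpha_k=e^{-2\pi i\lambda'_k}-1$ if $\lambda'_k\notin\mathbb Z$ and $\alpha_k=2\pi i$ if $\lambda'_k\in\mathbb Z$. The matrix $\Psi$ need not be a fundamental matrix. The loop is based at a point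 of $\mathcal P_\eta$ close to $\lambda_k$ (it crosses only the cut $L_k$). *)

theory Defs
  imports "HOL-Complex_Analysis.Complex_Analysis"
begin

subsection \<open>Branch cuts\<close>

definition admissible :: "real \<Rightarrow> ('n::finite \<Rightarrow> complex) \<Rightarrow> bool" where
  "admissible \<eta> l \<longleftrightarrow>
     (\<forall>j k. j \<noteq> k \<longrightarrow> (\<forall>m::int. \<eta> \<noteq> Arg (l j - l k) + 2 * pi * of_int m))"

definition cut_ray :: "real \<Rightarrow> complex \<Rightarrow> complex set" where
  "cut_ray \<eta> a = {a + of_real t * cis \<eta> | t::real. t \<ge> 0}"

definition cut_plane :: "real \<Rightarrow> ('n::finite \<Rightarrow> complex) \<Rightarrow> complex set" where
  "cut_plane \<eta> l = - (\<Union>k. cut_ray \<eta> (l k))"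

text \<open>The rotation by \<open>pi - \<eta>\<close> moves the ray of direction \<open>\<eta>\<close> to the negative real axis, which is
  the cut of \<^const>\<open>Ln\<close>; see the two lemmas below.\<close>

definition branch_ln :: "real \<Rightarrow> complex \<Rightarrow> complex" where
  "branch_ln \<eta> z = Ln (z * cis (pi - \<eta>)) + \<i> * of_real (\<eta> - pi)"

definition branch_pow :: "real \<Rightarrow> complex \<Rightarrow> complex \<Rightarrow> complex" where
  "branch_pow \<eta> z a = exp (a * branch_ln \<eta> z)"

lemma exp_branch_ln:
  assumes "z \<noteq> 0"
  shows "exp (branch_ln \<eta> z) = z"
proof -
  have "exp (branch_ln \<eta> z) = z * (cis (pi - \<eta>) * cis (\<eta> - pi))"
    using assms by (simp add: branch_ln_def exp_add cis_conv_exp mult.assoc)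
  also have "cis (pi - \<eta>) * cis (\<eta> - pi) = 1"
    by (simp add: cis_mult)
  finally show ?thesis by simp
qed

lemma Im_branch_ln:
  assumes "z \<notin> cut_ray \<eta> 0"
  shows "\<eta> - 2 * pi < Im (branch_ln \<eta> z)" "Im (branch_ln \<eta> z) < \<eta>"
proof -
  have z0: "z \<noteq> 0"
    using assms unfolding cut_ray_def by (auto intro: exI[of _ 0])
  let ?w = "z * cis (pi - \<eta>)"
  have w0: "?w \<noteq> 0" using z0 by simp
  have "Im (Ln ?w) \<noteq> pi"
  proof
    assume "Im (Ln ?w) = pi"
    then have "?w = of_real (cmod ?w) * cis pi"
      using w0 by (metis Arg_def Arg_eq cis_conv_exp)
    then have "?w * cis (\<eta> - pi) = of_real (cmod ?w) * (cis pi * cis (\<eta> - pi))"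
      by (metis mult.assoc)
    moreover have "?w * cis (\<eta> - pi) = z"
      by (simp add: mult.assoc cis_mult)
    ultimately have "z = 0 + of_real (cmod ?w) * cis \<eta>"
      by (simp only: cis_mult) simp
    then have "z \<in> cut_ray \<eta> 0"
      unfolding cut_ray_def using norm_ge_zero by blast
    with assms show False by simp
  qed
  then show "\<eta> - 2 * pi < Im (branch_ln \<eta> z)" "Im (branch_ln \<eta> z) < \<eta>"
    using mpi_less_Im_Ln[OF w0] Im_Ln_le_pi[OF w0] by (auto simp: branch_ln_def)
qed


subsection \<open>The system and its solutions on the cut plane\<close>

definition diag_matrix :: "('n::finite \<Rightarrow> complex) \<Rightarrow> complex^'n^'n" where
  "diag_matrix l = (\<chi> i j. if i = j then l i else 0)"

definition vec_analytic_at :: "(complex \<Rightarrow> complex^'n) \<Rightarrow> complex \<Rightarrow> bool" where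
  "vec_analytic_at r a \<longleftrightarrow> (\<forall>i. (\<lambda>z. r z $ i) analytic_on {a})"

definition vec_deriv :: "(complex \<Rightarrow> complex^'n) \<Rightarrow> complex \<Rightarrow> complex^'n" where
  "vec_deriv f z = (\<chi> i. deriv (\<lambda>w. f w $ i) z)"

definition is_solution ::
  "real \<Rightarrow> ('n::finite \<Rightarrow> complex) \<Rightarrow> complex^'n^'n \<Rightarrow> (complex \<Rightarrow> complex^'n) \<Rightarrow> bool" where
  "is_solution \<eta> l A1 f \<longleftrightarrow>
     (\<forall>i. (\<lambda>z. f z $ i) holomorphic_on cut_plane \<eta> l) \<and>
     (\<forall>z\<in>cut_plane \<eta> l. (diag_matrix l - mat z) *v vec_deriv f z = (A1 + mat 1) *v f z)"

text \<open>\<open>f\<close> is \<open>(v + b\<^sub>1 (z - l k) + b\<^sub>2 (z - l k)\<^sup>2 + \<dots>) (z - l k)\<^sup>a\<close> near \<open>l k\<close>.\<close>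

definition power_form ::
  "real \<Rightarrow> ('n::finite \<Rightarrow> complex) \<Rightarrow> 'n \<Rightarrow> complex^'n \<Rightarrow> complex \<Rightarrow> (complex \<Rightarrow> complex^'n) \<Rightarrow> bool"
where
  "power_form \<eta> l k v a f \<longleftrightarrow>
     (\<exists>b::nat \<Rightarrow> complex^'n. b 0 = v \<and>
        (\<forall>\<^sub>F z in at (l k) within cut_plane \<eta> l.
           \<exists>s. (\<lambda>m. (z - l k) ^ m *s b m) sums s \<and> f z = branch_pow \<eta> (z - l k) a *s s))"

definition log_form ::
  "real \<Rightarrow> ('n::finite \<Rightarrow> complex) \<Rightarrow> 'n \<Rightarrow> (complex \<Rightarrow> complex^'n) \<Rightarrow> (complex \<Rightarrow> complex^'n) \<Rightarrow> bool"
where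
  "log_form \<eta> l k f g \<longleftrightarrow>
     (\<exists>r. vec_analytic_at r (l k) \<and>
        (\<forall>\<^sub>F z in at (l k) within cut_plane \<eta> l.
           g z = branch_ln \<eta> (z - l k) *s f z + r z))"

definition log_pole_form ::
  "real \<Rightarrow> ('n::finite \<Rightarrow> complex) \<Rightarrow> 'n \<Rightarrow> nat \<Rightarrow> (complex \<Rightarrow> complex^'n) \<Rightarrow> (complex \<Rightarrow> complex^'n) \<Rightarrow> bool"
where
  "log_pole_form \<eta> l k N f g \<longleftrightarrow>
     (\<exists>(p::nat \<Rightarrow> complex^'n) r. p 0 = fact N *s axis k 1 \<and> vec_analytic_at r (l k) \<and>
        (\<forall>\<^sub>F z in at (l k) within cut_plane \<eta> l.
           g z = branch_ln \<eta> (z - l k) *s f z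
               + (1 / (z - l k) ^ (N + 1)) *s (\<Sum>m\<le>N. (z - l k) ^ m *s p m)
               + r z))"

definition is_Psi ::
  "real \<Rightarrow> ('n::finite \<Rightarrow> complex) \<Rightarrow> complex^'n^'n \<Rightarrow> 'n \<Rightarrow> (complex \<Rightarrow> complex^'n) \<Rightarrow> bool" where
  "is_Psi \<eta> l A1 k f \<longleftrightarrow>
     is_solution \<eta> l A1 f \<and>
     (A1 $ k $ k \<notin> \<int> \<longrightarrow>
        power_form \<eta> l k (Gamma (A1 $ k $ k + 1) *s axis k 1) (- (A1 $ k $ k) - 1) f) \<and>
     (\<forall>N::int. A1 $ k $ k = of_int N \<and> N < 0 \<longrightarrow>
        power_form \<eta> l k (((-1) powi N / fact (nat (- N - 1))) *s axis k 1) (of_int (- N - 1)) f) \<and>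
     (\<forall>N::nat. A1 $ k $ k = of_nat N \<longrightarrow>
        (\<exists>r. vec_analytic_at r (l k) \<and> (\<forall>\<^sub>F z in at (l k) within cut_plane \<eta> l. f z = r z)) \<and>
        (\<exists>g. is_solution \<eta> l A1 g \<and> log_pole_form \<eta> l k N f g))"

text \<open>Here \<open>f\<close> is the solution attached to \<open>l k\<close> by \<^const>\<open>is_Psi\<close>, and \<open>S\<close> a singular solution at
  \<open>l k\<close> belonging to it.\<close>

definition is_Psi_sing ::
  "real \<Rightarrow> ('n::finite \<Rightarrow> complex) \<Rightarrow> complex^'n^'n \<Rightarrow> 'n
     \<Rightarrow> (complex \<Rightarrow> complex^'n) \<Rightarrow> (complex \<Rightarrow> complex^'n) \<Rightarrow> bool"
where
  "is_Psi_sing \<eta> l A1 k f S \<longleftrightarrow>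
     (A1 $ k $ k \<notin> \<int> \<longrightarrow> (\<forall>z\<in>cut_plane \<eta> l. S z = f z)) \<and>
     (\<forall>N::nat. A1 $ k $ k = of_nat N \<longrightarrow>
        is_solution \<eta> l A1 S \<and> log_pole_form \<eta> l k N f S) \<and>
     (\<forall>N::int. A1 $ k $ k = of_int N \<and> N < 0 \<longrightarrow>
        (if \<exists>g. is_solution \<eta> l A1 g \<and> log_form \<eta> l k f g
         then is_solution \<eta> l A1 S \<and> log_form \<eta> l k f S
         else (\<forall>z\<in>cut_plane \<eta> l. S z = 0)))"


subsection \<open>Connection coefficients and monodromy\<close>

definition is_connection_coeffs ::
  "real \<Rightarrow> ('n::finite \<Rightarrow> complex) \<Rightarrow> ('n \<Rightarrow> complex \<Rightarrow> complex^'n) \<Rightarrow> ('n \<Rightarrow> complex \<Rightarrow> complex^'n)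
     \<Rightarrow> ('n \<Rightarrow> 'n \<Rightarrow> complex) \<Rightarrow> bool"
where
  "is_connection_coeffs \<eta> l \<psi> S c \<longleftrightarrow>
     (\<forall>j k. \<exists>r. vec_analytic_at r (l j) \<and>
        (\<forall>\<^sub>F z in at (l j) within cut_plane \<eta> l. \<psi> k z = c j k *s S j z + r z)) \<and>
     (\<forall>j. (\<forall>z\<in>cut_plane \<eta> l. S j z = 0) \<longrightarrow> (\<forall>k. c j k = 0))"

definition alpha :: "complex^'n^'n \<Rightarrow> 'n::finite \<Rightarrow> complex" where
  "alpha A1 k = (if A1 $ k $ k \<notin> \<int> then exp (- 2 * of_real pi * \<i> * A1 $ k $ k) - 1
                 else 2 * of_real pi * \<i>)"

definition monodromy_matrix ::
  "complex^'n^'n \<Rightarrow> ('n \<Rightarrow> 'n \<Rightarrow> complex) \<Rightarrow> 'n::finite \<Rightarrow> complex^'n^'n" where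
  "monodromy_matrix A1 c k =
     (\<chi> i j. if i = j then (if j = k then exp (- 2 * of_real pi * \<i> * A1 $ k $ k) else 1)
             else if i = k then alpha A1 k * c k j
             else 0)"

definition matrix_of_columns :: "('n \<Rightarrow> complex \<Rightarrow> complex^'n) \<Rightarrow> complex \<Rightarrow> complex^'n^'n" where
  "matrix_of_columns \<psi> z = (\<chi> i j. \<psi> j z $ i)"

text \<open>The germ of \<open>f\<close> at the start of \<open>\<gamma>\<close> has an analytic continuation along \<open>\<gamma>\<close>, and it ends with
  the germ of \<open>g\<close>. The function \<open>F t\<close> matters only near \<open>\<gamma> t\<close>. The final germ is unique by the
  identity theorem.\<close>

definition continues_along ::
  "(real \<Rightarrow> complex) \<Rightarrow> (complex \<Rightarrow> complex) \<Rightarrow> (complex \<Rightarrow> complex) \<Rightarrow> bool" where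
  "continues_along \<gamma> f g \<longleftrightarrow>
     (\<exists>F::real \<Rightarrow> complex \<Rightarrow> complex.
        (\<forall>t\<in>{0..1}. F t analytic_on {\<gamma> t}) \<and>
        (\<forall>t\<in>{0..1}. \<forall>\<^sub>F s in at t within {0..1}. \<forall>\<^sub>F z in nhds (\<gamma> s). F s z = F t z) \<and>
        (\<forall>\<^sub>F z in nhds (pathstart \<gamma>). F 0 z = f z) \<and>
        (\<forall>\<^sub>F z in nhds (pathfinish \<gamma>). F 1 z = g z))"

definition vec_continues_along ::
  "(real \<Rightarrow> complex) \<Rightarrow> (complex \<Rightarrow> complex^'n) \<Rightarrow> (complex \<Rightarrow> complex^'n) \<Rightarrow> bool" where
  "vec_continues_along \<gamma> f g \<longleftrightarrow> (\<forall>i. continues_along \<gamma> (\<lambda>z. f z $ i) (\<lambda>z. g z $ i))"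

definition matrix_continues_along ::
  "(real \<Rightarrow> complex) \<Rightarrow> (complex \<Rightarrow> complex^'n^'m) \<Rightarrow> (complex \<Rightarrow> complex^'n^'m) \<Rightarrow> bool" where
  "matrix_continues_along \<gamma> f g \<longleftrightarrow>
     (\<forall>i j. continues_along \<gamma> (\<lambda>z. f z $ i $ j) (\<lambda>z. g z $ i $ j))"

text \<open>A loop in the punctured disc of radius \<open>\<epsilon>\<close> about \<open>l k\<close>, based off the cuts, going round
  \<open>l k\<close> once anticlockwise.\<close>

definition small_loop ::
  "real \<Rightarrow> ('n::finite \<Rightarrow> complex) \<Rightarrow> 'n \<Rightarrow> real \<Rightarrow> (real \<Rightarrow> complex) \<Rightarrow> bool" where
  "small_loop \<eta> l k \<epsilon> \<gamma> \<longleftrightarrow>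
     path \<gamma> \<and> pathfinish \<gamma> = pathstart \<gamma> \<and> pathstart \<gamma> \<in> cut_plane \<eta> l \<and>
     path_image \<gamma> \<subseteq> ball (l k) \<epsilon> - {l k} \<and> winding_number \<gamma> (l k) = 1"

end

theory Submission
  imports Defs
begin

no_notation fps_nth (infixl "$" 75)

text \<open>Near \<open>l k\<close> every function involved is an analytic function of \<open>w = ln (z - l k)\<close>, i.e. it
  lifts to the universal cover of the punctured disc, a half plane. Continuation along a loop of
  winding number one is the deck transformation \<open>w \<mapsto> w + 2\<pi>i\<close>, so it can be read off the
  prescribed local forms.\<close>

subsection \<open>Continuation through the logarithm\<close>

text \<open>\<open>K\<close> is the lift through \<open>w \<mapsto> a + exp w\<close>. Values of
  \<open>f\<close> and \<open>g\<close> enter only on \<open>D\<close>, where the branch is fixed;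
  the continuation across the cut is carried by the holomorphy of \<open>K\<close>.\<close>

definition has_monodromy ::
  "real \<Rightarrow> complex set \<Rightarrow> complex \<Rightarrow> (complex \<Rightarrow> complex) \<Rightarrow> (complex \<Rightarrow> complex) \<Rightarrow> bool" where
  "has_monodromy \<eta> D a f g \<longleftrightarrow>
     (\<exists>K \<epsilon>. \<epsilon> > 0 \<and> K holomorphic_on {w. norm (exp w) < \<epsilon>} \<and>
        (\<forall>\<^sub>F z in at a within D. f z = K (branch_ln \<eta> (z - a)) \<and>
           g z = K (branch_ln \<eta> (z - a) + 2 * of_real pi * \<i>)))"

lemma has_monodromyI:
  assumes "\<epsilon> > 0" "K holomorphic_on {w. norm (exp w) < \<epsilon>}"
    "\<forall>\<^sub>F z in at a within D. f z = K (branch_ln \<eta> (z - a)) \<and>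
       g z = K (branch_ln \<eta> (z - a) + 2 * of_real pi * \<i>)"
  shows "has_monodromy \<eta> D a f g"
  using assms unfolding has_monodromy_def by blast

lemma has_monodromy_cong:
  assumes "has_monodromy \<eta> D a f g"
    "\<forall>\<^sub>F z in at a within D. f' z = f z" "\<forall>\<^sub>F z in at a within D. g' z = g z"
  shows "has_monodromy \<eta> D a f' g'"
proof -
  obtain K \<epsilon> where K: "\<epsilon> > 0" "K holomorphic_on {w. norm (exp w) < \<epsilon>}"
    "\<forall>\<^sub>F z in at a within D. f z = K (branch_ln \<eta> (z - a)) \<and>
       g z = K (branch_ln \<eta> (z - a) + 2 * of_real pi * \<i>)"
    using assms(1) unfolding has_monodromy_def by blast
  show ?thesis
    by (rule has_monodromyI[OF K(1,2)]) (use K(3) assms(2,3) in eventually_elim, simp)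
qed

text \<open>Lifts are added and multiplied pointwise on the smaller of the two half planes, and
  translation by \<open>2 * pi * \<i>\<close> respects both operations.\<close>

lemma has_monodromy_combine:
  assumes "has_monodromy \<eta> D a f1 g1" "has_monodromy \<eta> D a f2 g2"
  shows "has_monodromy \<eta> D a (\<lambda>z. f1 z + f2 z) (\<lambda>z. g1 z + g2 z)"
    and "has_monodromy \<eta> D a (\<lambda>z. f1 z * f2 z) (\<lambda>z. g1 z * g2 z)"
proof -
  obtain K1 \<epsilon>1 where K1: "\<epsilon>1 > 0" "K1 holomorphic_on {w. norm (exp w) < \<epsilon>1}"
    "\<forall>\<^sub>F z in at a within D. f1 z = K1 (branch_ln \<eta> (z - a)) \<and>
       g1 z = K1 (branch_ln \<eta> (z - a) + 2 * of_real pi * \<i>)"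
    using assms(1) unfolding has_monodromy_def by blast
  obtain K2 \<epsilon>2 where K2: "\<epsilon>2 > 0" "K2 holomorphic_on {w. norm (exp w) < \<epsilon>2}"
    "\<forall>\<^sub>F z in at a within D. f2 z = K2 (branch_ln \<eta> (z - a)) \<and>
       g2 z = K2 (branch_ln \<eta> (z - a) + 2 * of_real pi * \<i>)"
    using assms(2) unfolding has_monodromy_def by blast
  define \<epsilon> where "\<epsilon> = min \<epsilon>1 \<epsilon>2"
  have \<epsilon>: "\<epsilon> > 0" using K1 K2 by (simp add: \<epsilon>_def)
  have hol: "K1 holomorphic_on {w. norm (exp w) < \<epsilon>}" "K2 holomorphic_on {w. norm (exp w) < \<epsilon>}"
    using K1(2) K2(2) by (auto elim!: holomorphic_on_subset simp: \<epsilon>_def simp del: norm_exp_eq_Re)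
  show "has_monodromy \<eta> D a (\<lambda>z. f1 z + f2 z) (\<lambda>z. g1 z + g2 z)"
    by (rule has_monodromyI[OF \<epsilon>, of "\<lambda>w. K1 w + K2 w"])
       (intro holomorphic_intros hol, use K1(3) K2(3) in eventually_elim, simp)
  show "has_monodromy \<eta> D a (\<lambda>z. f1 z * f2 z) (\<lambda>z. g1 z * g2 z)"
    by (rule has_monodromyI[OF \<epsilon>, of "\<lambda>w. K1 w * K2 w"])
       (intro holomorphic_intros hol, use K1(3) K2(3) in eventually_elim, simp)
qed

section \<open>Lifts of the elementary functions\<close>

text \<open>The lift \<open>r (a + exp w)\<close> inherits the period of \<open>exp\<close>.\<close>

lemma has_monodromy_analytic:
  assumes "r analytic_on {a}"
  shows "has_monodromy \<eta> D a r r"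
proof -
  obtain \<epsilon> where \<epsilon>: "\<epsilon> > 0" "r holomorphic_on ball a \<epsilon>"
    using assms by (auto simp: analytic_on_def)
  have "(r \<circ> (\<lambda>w. a + exp w)) holomorphic_on {w. norm (exp w) < \<epsilon>}"
    by (rule holomorphic_on_compose_gen[OF _ \<epsilon>(2)]) (auto intro!: holomorphic_intros simp: dist_norm)
  \<comment> \<open>\<open>exp (branch_ln \<eta> (z - a))\<close> returns \<open>z - a\<close> only
    off the centre.\<close>
  moreover have "\<forall>\<^sub>F z in at a within D. z \<noteq> a"
    by (simp add: eventually_at_filter)
  then have "\<forall>\<^sub>F z in at a within D. r z = (r \<circ> (\<lambda>w. a + exp w)) (branch_ln \<eta> (z - a)) \<and>
      r z = (r \<circ> (\<lambda>w. a + exp w)) (branch_ln \<eta> (z - a) + 2 * of_real pi * \<i>)"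
    by eventually_elim (simp add: exp_branch_ln exp_add exp_two_pi_i)
  ultimately show ?thesis using \<epsilon>(1) by (intro has_monodromyI)
qed

text \<open>The lift is the identity. It is entire, so the radius \<open>1\<close> is an arbitrary
  choice.\<close>

lemma has_monodromy_ln:
  "has_monodromy \<eta> D a (\<lambda>z. branch_ln \<eta> (z - a)) (\<lambda>z. branch_ln \<eta> (z - a) + 2 * of_real pi * \<i>)"
  by (rule has_monodromyI[of 1 "\<lambda>w. w"]) (auto intro: holomorphic_intros)

lemma has_monodromy_pow:
  "has_monodromy \<eta> D a (\<lambda>z. branch_pow \<eta> (z - a) b)
     (\<lambda>z. exp (2 * of_real pi * \<i> * b) * branch_pow \<eta> (z - a) b)"
  by (rule has_monodromyI[of 1 "\<lambda>w. exp (b * w)"])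
     (auto intro!: holomorphic_intros simp: branch_pow_def exp_add[symmetric] algebra_simps)

text \<open>For \<open>n > 0\<close> there is a pole at \<open>a\<close>, out of reach of
  \<open>has_monodromy_analytic\<close>; the lift is still holomorphic because \<open>exp\<close>
  never vanishes.\<close>

lemma has_monodromy_inverse_power:
  "has_monodromy \<eta> D a (\<lambda>z. 1 / (z - a) ^ n) (\<lambda>z. 1 / (z - a) ^ n)"
proof (rule has_monodromyI[of 1 "\<lambda>w. 1 / exp w ^ n"])
  have "\<forall>\<^sub>F z in at a within D. z \<noteq> a"
    by (simp add: eventually_at_filter)
  then show "\<forall>\<^sub>F z in at a within D. 1 / (z - a) ^ n = 1 / exp (branch_ln \<eta> (z - a)) ^ n \<and>
      1 / (z - a) ^ n = 1 / exp (branch_ln \<eta> (z - a) + 2 * of_real pi * \<i>) ^ n"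
    by eventually_elim (simp add: exp_branch_ln exp_add exp_two_pi_i)
qed (auto intro!: holomorphic_intros)

lemma has_monodromy_cmult:
  "has_monodromy \<eta> D a f g \<Longrightarrow> has_monodromy \<eta> D a (\<lambda>z. b * f z) (\<lambda>z. b * g z)"
  using has_monodromy_combine(2)[OF has_monodromy_analytic[of "\<lambda>_. b"]] by simp

section \<open>Power series and local branches of the logarithm\<close>

text \<open>Convergence at one point off the centre forces convergence in the open disc reaching to
  that point.\<close>

lemma power_series_analytic:
  fixes B :: "nat \<Rightarrow> complex"
  assumes "summable (\<lambda>m. B m * (z1 - a) ^ m)" "z1 \<noteq> a"
  shows "(\<lambda>z. \<Sum>m. B m * (z - a) ^ m) analytic_on {a}"
proof -
  have "(\<lambda>m. B m * (w - a) ^ m) sums (\<Sum>m. B m * (w - a) ^ m)" if "w \<in> ball a (norm (z1 - a))" for w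
    using powser_inside[OF assms(1), of "w - a"] that
    by (simp add: summable_sums dist_norm norm_minus_commute)
  then have "(\<lambda>z. \<Sum>m. B m * (z - a) ^ m) holomorphic_on ball a (norm (z1 - a))"
    by (rule power_series_holomorphic)
  then show ?thesis
    using assms(2) by (auto simp: analytic_on_def intro!: exI[of _ "norm (z1 - a)"])
qed

text \<open>The logarithm near \<open>z0\<close> that takes the value \<open>w0\<close> there is \<open>w0 + Ln (z / z0)\<close>.\<close>

lemma Ln_near:
  fixes z0 c a :: complex
  assumes "c * (z0 - a) \<notin> \<real>\<^sub>\<le>\<^sub>0"
  shows "\<forall>\<^sub>F z in nhds z0. Ln (c * (z - a)) = Ln (c * (z0 - a)) + Ln ((z - a) / (z0 - a))"
proof -
  let ?w = "c * (z0 - a)"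
  have w: "?w \<noteq> 0" using assms by auto
  have za: "z0 \<noteq> a" using w by auto
  \<comment> \<open>\<open>h\<close> is the imaginary part of the proposed sum. Principal logarithms
    add as long as it stays in the principal strip; it lies strictly inside at \<open>z0\<close>,
    hence also nearby.\<close>
  define h where "h z = Im (Ln ?w) + Im (Ln ((z - a) / (z0 - a)))" for z
  have "isCont h z0"
    unfolding h_def using za by (intro continuous_intros) auto
  moreover have "h z0 = Im (Ln ?w)"
    using za by (simp add: h_def)
  ultimately have lim: "(h \<longlongrightarrow> Im (Ln ?w)) (nhds z0)"
    using tendsto_at_iff_tendsto_nhds[of h z0] by (simp add: isCont_def)
  have Im: "- pi < Im (Ln ?w)" "Im (Ln ?w) < pi"
    using assms w mpi_less_Im_Ln Im_Ln_less_pi by auto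
  have ne: "\<forall>\<^sub>F z in nhds z0. z \<noteq> a"
    using za by (rule t1_space_nhds)
  from order_tendstoD(1)[OF lim Im(1)] order_tendstoD(2)[OF lim Im(2)] ne
  show ?thesis
  proof eventually_elim
    case (elim z)
    then have "Ln (?w * ((z - a) / (z0 - a))) = Ln ?w + Ln ((z - a) / (z0 - a))"
      using w za by (intro Ln_times_simple) (auto simp: h_def)
    then show ?case using za by simp
  qed
qed

text \<open>Rotation by \<open>pi - \<eta>\<close> carries the cut to that of \<open>Ln\<close>, so
  \<open>Ln_near\<close> applies with \<open>c = cis (pi - \<eta>)\<close>.\<close>

lemma branch_ln_near:
  assumes "z0 - a \<notin> cut_ray \<eta> 0"
  shows "\<forall>\<^sub>F z in nhds z0. branch_ln \<eta> (z - a) = branch_ln \<eta> (z0 - a) + Ln ((z - a) / (z0 - a))"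
proof -
  have "cis (pi - \<eta>) * (z0 - a) \<notin> \<real>\<^sub>\<le>\<^sub>0"
  proof
    assume "cis (pi - \<eta>) * (z0 - a) \<in> \<real>\<^sub>\<le>\<^sub>0"
    then obtain t where t: "t \<le> 0" "cis (pi - \<eta>) * (z0 - a) = of_real t"
      by (auto elim!: nonpos_Reals_cases)
    \<comment> \<open>Undo the rotation: since \<open>cis (\<eta> - pi) = - cis \<eta>\<close>, the
      nonpositive \<open>t\<close> becomes the ray parameter \<open>- t\<close>.\<close>
    have "z0 - a = cis (\<eta> - pi) * (cis (pi - \<eta>) * (z0 - a))"
      by (simp add: mult.assoc[symmetric] cis_mult)
    also have "\<dots> = 0 + of_real (- t) * cis \<eta>"
      unfolding t(2) by (simp add: cis_divide[symmetric])
    finally show False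
      using assms t(1) unfolding cut_ray_def by (metis (mono_tags, lifting) mem_Collect_eq neg_0_le_iff_le)
  qed
  from Ln_near[OF this] show ?thesis
    by eventually_elim (simp add: branch_ln_def mult.commute)
qed

section \<open>Topology of the cut plane\<close>

text \<open>In the coordinate \<open>(z - a) * cis (- \<eta>)\<close> the ray is the nonnegative
  real axis, given by closed conditions on continuous functions.\<close>

lemma closed_cut_ray: "closed (cut_ray \<eta> a)"
proof -
  have "cut_ray \<eta> a = (\<lambda>z. a + z * cis \<eta>) ` (of_real ` {0..})"
    by (auto simp: cut_ray_def image_image)
  also have "\<dots> = {z. Im ((z - a) * cis (- \<eta>)) = 0 \<and> 0 \<le> Re ((z - a) * cis (- \<eta>))}"
  proof (intro set_eqI iffI)
    fix z assume "z \<in> {z. Im ((z - a) * cis (- \<eta>)) = 0 \<and> 0 \<le> Re ((z - a) * cis (- \<eta>))}"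
    then have "(z - a) * cis (- \<eta>) = of_real (Re ((z - a) * cis (- \<eta>)))"
      "0 \<le> Re ((z - a) * cis (- \<eta>))"
      by (auto simp: complex_eq_iff)
    moreover have "z = a + ((z - a) * cis (- \<eta>)) * cis \<eta>"
      by (simp add: mult.assoc cis_mult)
    ultimately show "z \<in> (\<lambda>z. a + z * cis \<eta>) ` (of_real ` {0..})"
      by (metis (no_types, lifting) atLeast_iff image_eqI)
  qed (auto simp: mult.assoc cis_mult)
  also have "closed \<dots>"
    by (intro closed_Collect_conj closed_Collect_eq closed_Collect_le continuous_intros)
  finally show ?thesis .
qed

lemma open_cut_plane: "open (cut_plane \<eta> l)"
  by (auto simp: cut_plane_def intro!: closed_cut_ray)

lemma cut_plane_diff:
  assumes "z \<in> cut_plane \<eta> l"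
  shows "z - l k \<notin> cut_ray \<eta> 0"
proof
  assume "z - l k \<in> cut_ray \<eta> 0"
  then obtain t where "z - l k = of_real t * cis \<eta>" "t \<ge> 0"
    by (auto simp: cut_ray_def)
  then have "z = l k + of_real t * cis \<eta>" "t \<ge> 0"
    by (auto simp: algebra_simps)
  then have "z \<in> cut_ray \<eta> (l k)"
    unfolding cut_ray_def by blast
  with assms show False by (auto simp: cut_plane_def)
qed

section \<open>Lifted loops and continuation of germs\<close>

text \<open>The winding number measures the net change of a continuous logarithm along the path, so
  winding number one means that the lift ends one period above its start.\<close>

lemma log_lift_of_loop:
  assumes "path \<gamma>" "pathfinish \<gamma> = pathstart \<gamma>" "a \<notin> path_image \<gamma>" "winding_number \<gamma> a = 1"
    "exp w0 = pathstart \<gamma> - a"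
  obtains q where "path q" "q 0 = w0" "q 1 = w0 + 2 * of_real pi * \<i>"
    "\<And>t. t \<in> {0..1} \<Longrightarrow> \<gamma> t - a = exp (q t)"
proof -
  obtain p where p: "path p"
    "pathfinish p - pathstart p = 2 * of_real pi * \<i> * winding_number \<gamma> a"
    "\<And>t. t \<in> {0..1} \<Longrightarrow> \<gamma> t = a + exp (p t)"
    using winding_number_as_continuous_log[OF assms(1,3)] by blast
  \<comment> \<open>Both \<open>w0\<close> and \<open>p 0\<close> are logarithms of
    \<open>pathstart \<gamma> - a\<close>, so the shift is a period of \<open>exp\<close> and only
    adjusts the starting value.\<close>
  define q where "q t = p t + (w0 - p 0)" for t
  have "exp (p 0) = exp w0"
    using p(3)[of 0] assms(5) by (simp add: pathstart_def)
  then have "exp (w0 - p 0) = 1"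
    by (simp add: exp_diff)
  then have "exp (q t) = exp (p t)" for t
    by (simp add: q_def exp_add)
  then show thesis
    using p assms(4)
    by (intro that[of q])
       (auto simp: q_def[abs_def] path_def pathfinish_def pathstart_def algebra_simps
         intro!: continuous_intros)
qed

text \<open>Compose \<open>K\<close> with the branch of the logarithm that follows the lifted loop:
  it starts as \<open>branch_ln\<close> and ends one period higher, turning \<open>f\<close> into
  \<open>g\<close>. The radius is kept as an eventuality so that finitely many such statements can
  share one.\<close>

lemma has_monodromy_continues_along:
  assumes "has_monodromy \<eta> (cut_plane \<eta> l) (l k) f g"
  shows "\<forall>\<^sub>F \<epsilon> in at_right 0. \<forall>\<gamma>. small_loop \<eta> l k \<epsilon> \<gamma> \<longrightarrow> continues_along \<gamma> f g"
proof -
  let ?a = "l k"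
  obtain K \<epsilon>1 where K: "\<epsilon>1 > 0" "K holomorphic_on {w. norm (exp w) < \<epsilon>1}"
    "\<forall>\<^sub>F z in at ?a within cut_plane \<eta> l. f z = K (branch_ln \<eta> (z - ?a)) \<and>
       g z = K (branch_ln \<eta> (z - ?a) + 2 * of_real pi * \<i>)"
    using assms unfolding has_monodromy_def by blast
  obtain \<epsilon>2 where \<epsilon>2: "\<epsilon>2 > 0"
    "\<And>z. \<lbrakk>z \<in> cut_plane \<eta> l; z \<noteq> ?a; dist z ?a < \<epsilon>2\<rbrakk> \<Longrightarrow> f z = K (branch_ln \<eta> (z - ?a)) \<and>
       g z = K (branch_ln \<eta> (z - ?a) + 2 * of_real pi * \<i>)"
    using K(3) unfolding eventually_at by blast
  \<comment> \<open>Below \<open>\<epsilon>1\<close> the lifted loop stays in the domain of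
    \<open>K\<close>; below \<open>\<epsilon>2\<close> the base point lies where \<open>K\<close>
    describes \<open>f\<close> and \<open>g\<close>.\<close>
  have "continues_along \<gamma> f g" if \<epsilon>: "\<epsilon> < min \<epsilon>1 \<epsilon>2" and "small_loop \<eta> l k \<epsilon> \<gamma>" for \<epsilon> \<gamma>
  proof -
    have \<gamma>: "path \<gamma>" "pathfinish \<gamma> = pathstart \<gamma>" "pathstart \<gamma> \<in> cut_plane \<eta> l"
      "path_image \<gamma> \<subseteq> ball ?a \<epsilon> - {?a}" "winding_number \<gamma> ?a = 1"
      using that(2) by (auto simp: small_loop_def)
    define z0 where "z0 = pathstart \<gamma>"
    have ends: "\<gamma> 0 = z0" "\<gamma> 1 = z0"
      using \<gamma>(2) by (auto simp: z0_def pathstart_def pathfinish_def)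
    have z0: "z0 \<in> cut_plane \<eta> l" "z0 \<noteq> ?a" "dist z0 ?a < \<epsilon>2"
      using \<gamma>(3,4) \<epsilon> pathstart_in_path_image[of \<gamma>] by (auto simp: z0_def dist_commute)
    obtain q where q: "path q" "q 0 = branch_ln \<eta> (z0 - ?a)"
      "q 1 = branch_ln \<eta> (z0 - ?a) + 2 * of_real pi * \<i>"
      "\<And>t. t \<in> {0..1} \<Longrightarrow> \<gamma> t - ?a = exp (q t)"
      using log_lift_of_loop[OF \<gamma>(1,2) _ \<gamma>(5), of "branch_ln \<eta> (z0 - ?a)"] \<gamma>(4) z0(2)
      by (auto simp: exp_branch_ln z0_def)
    have \<gamma>t: "\<gamma> t \<noteq> ?a" "dist (\<gamma> t) ?a < \<epsilon>1" if "t \<in> {0..1}" for t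
      using \<gamma>(4) that \<epsilon> by (force simp: path_image_def dist_commute)+
    define L where "L t z = q t + Ln ((z - ?a) / (\<gamma> t - ?a))" for t z
    \<comment> \<open>Built from \<open>K\<close> and not from \<open>f\<close>, these germs make
      sense where the loop crosses the cut.\<close>
    define F where "F t = K \<circ> L t" for t
    have anF: "F t analytic_on {\<gamma> t}" if t: "t \<in> {0..1}" for t
    proof -
      have "L t analytic_on {\<gamma> t}"
        unfolding L_def using \<gamma>t[OF t] by (auto intro!: analytic_intros)
      moreover have "open {w. norm (exp w :: complex) < \<epsilon>1}"
        by (intro open_Collect_less continuous_intros)
      then have "K analytic_on {w. norm (exp w) < \<epsilon>1}"
        using K(2) by (simp add: analytic_on_open)
      \<comment> \<open>Here \<open>exp (L t (\<gamma> t)) = \<gamma> t - ?a\<close>, whose modulus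
        is below \<open>\<epsilon>1\<close>.\<close>
      moreover have "L t (\<gamma> t) \<in> {w. norm (exp w) < \<epsilon>1}"
        using \<gamma>t[OF t] q(4)[OF t] unfolding mem_Collect_eq
        by (simp add: L_def dist_norm del: norm_exp_eq_Re)
      ultimately show ?thesis
        unfolding F_def by (intro analytic_on_compose_gen) auto
    qed
    have locF: "\<forall>\<^sub>F s in at t within {0..1}. \<forall>\<^sub>F z in nhds (\<gamma> s). F s z = F t z"
      if t: "t \<in> {0..1}" for t
    proof -
      have "(q \<longlongrightarrow> q t) (at t within {0..1})"
        using q(1) t by (auto simp: path_def continuous_on_def)
      \<comment> \<open>A distance below \<open>1 < pi\<close> keeps \<open>q s - q t\<close> in the
        strip where \<open>Ln\<close> inverts \<open>exp\<close>, so the branches for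
        \<open>s\<close> and \<open>t\<close> agree near \<open>\<gamma> s\<close>.\<close>
      then have "\<forall>\<^sub>F s in at t within {0..1}. dist (q s) (q t) < 1"
        by (rule tendstoD) simp
      moreover have "\<forall>\<^sub>F s in at t within {0..1}. s \<in> {0..1}"
        by (simp add: eventually_at_filter)
      ultimately show ?thesis
      proof eventually_elim
        case (elim s)
        have "norm (q s - q t) < pi"
          using elim(1) pi_gt3 by (simp add: dist_norm)
        then have "\<bar>Im (q s - q t)\<bar> < pi"
          using abs_Im_le_cmod[of "q s - q t"] by linarith
        then have Im: "- pi < Im (q s - q t)" "Im (q s - q t) < pi"
          by linarith+
        have e: "inverse (\<gamma> t - ?a) * (\<gamma> s - ?a) = exp (q s - q t)"
          using q(4)[OF t] q(4)[OF elim(2)] by (simp add: exp_diff field_simps)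
        have Ln: "Ln (exp (q s - q t)) = q s - q t"
          using Im by (intro Ln_exp) auto
        \<comment> \<open>A nonzero value on the cut of \<open>Ln\<close> would have a logarithm
          with imaginary part \<open>pi\<close>.\<close>
        have "exp (q s - q t) \<notin> \<real>\<^sub>\<le>\<^sub>0"
        proof
          assume "exp (q s - q t) \<in> \<real>\<^sub>\<le>\<^sub>0"
          then have "Im (exp (q s - q t)) = 0" "Re (exp (q s - q t)) \<le> 0"
            by (auto simp: complex_nonpos_Reals_iff)
          moreover from this have "Re (exp (q s - q t)) \<noteq> 0"
            using exp_not_eq_zero[of "q s - q t"] by (metis complex_eqI zero_complex.sel)
          ultimately have "Im (Ln (exp (q s - q t))) = pi"
            by (simp add: Im_Ln_eq_pi)
          with Im Ln show False by simp
        qed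
        \<comment> \<open>Recentring at \<open>\<gamma> s\<close> gives \<open>L t z = q t + (q s -
          q t) + Ln ((z - ?a) / (\<gamma> s - ?a)) = L s z\<close>.\<close>
        then have "\<forall>\<^sub>F z in nhds (\<gamma> s). Ln (inverse (\<gamma> t - ?a) * (z - ?a)) =
            Ln (inverse (\<gamma> t - ?a) * (\<gamma> s - ?a)) + Ln ((z - ?a) / (\<gamma> s - ?a))"
          by (intro Ln_near) (simp add: e)
        then show ?case
          by eventually_elim (simp add: F_def L_def e Ln, simp add: divide_inverse mult.commute)
      qed
    qed
    \<comment> \<open>Near the base point \<open>L 0 z\<close> is therefore
      \<open>branch_ln \<eta> (z - ?a)\<close>, and \<open>L 1 z\<close> is one period more.\<close>
    have near: "\<forall>\<^sub>F z in nhds z0. z \<in> cut_plane \<eta> l \<and> z \<noteq> ?a \<and> dist z ?a < \<epsilon>2 \<and>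
        branch_ln \<eta> (z - ?a) = branch_ln \<eta> (z0 - ?a) + Ln ((z - ?a) / (z0 - ?a))"
    proof (intro eventually_conj)
      show "\<forall>\<^sub>F z in nhds z0. z \<in> cut_plane \<eta> l"
        using open_cut_plane z0(1) by (rule eventually_nhds_in_open)
      show "\<forall>\<^sub>F z in nhds z0. z \<noteq> ?a"
        using z0(2) by (rule t1_space_nhds)
      show "\<forall>\<^sub>F z in nhds z0. dist z ?a < \<epsilon>2"
        using eventually_nhds_in_open[of "ball ?a \<epsilon>2" z0] z0(3) by (simp add: dist_commute)
    qed (rule branch_ln_near[OF cut_plane_diff[OF z0(1)]])
    have "\<forall>\<^sub>F z in nhds z0. F 0 z = f z" "\<forall>\<^sub>F z in nhds z0. F 1 z = g z"
      by (use near in eventually_elim, use \<epsilon>2(2) q(2,3) ends in \<open>simp add: F_def L_def algebra_simps\<close>)+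
    then show ?thesis
      unfolding continues_along_def using anF locF ends
      by (intro exI[of _ F]) (auto simp: pathstart_def pathfinish_def)
  qed
  then show ?thesis
    unfolding eventually_at_right_field using K(1) \<epsilon>2(1)
    by (intro exI[of _ "min \<epsilon>1 \<epsilon>2"]) auto
qed

subsection \<open>Monodromy of the prescribed local forms\<close>

lemma exp_two_pi_i_of_int: "exp (2 * of_real pi * \<i> * of_int N) = 1"
  using exp_integer_2pi[of "of_int N"] by (simp add: mult_ac)

text \<open>The series sums to a function analytic at \<open>l k\<close>, so the whole multiplier
  comes from the power.\<close>

lemma power_form_monodromy:
  fixes l :: "'n::finite \<Rightarrow> complex" and f :: "complex \<Rightarrow> complex^'n"
  assumes "power_form \<eta> l k v b f"
  shows "has_monodromy \<eta> (cut_plane \<eta> l) (l k) (\<lambda>z. f z $ i)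
           (\<lambda>z. exp (2 * of_real pi * \<i> * b) * f z $ i)"
\<comment> \<open>With a trivial filter any lift serves. Otherwise the filter yields a point
  \<open>z1\<close> where the series converges, which is what analyticity of its sum
  requires.\<close>
proof (cases "at (l k) within cut_plane \<eta> l = bot")
  case True
  then show ?thesis
    by (intro has_monodromyI[of 1 "\<lambda>_. 0"]) auto
next
  case False
  obtain B where B: "\<forall>\<^sub>F z in at (l k) within cut_plane \<eta> l.
      \<exists>s. (\<lambda>m. (z - l k) ^ m *s B m) sums s \<and> f z = branch_pow \<eta> (z - l k) b *s s"
    using assms unfolding power_form_def by blast
  \<comment> \<open>\<open>power_form\<close> gives a limit for each \<open>z\<close> separately;
    \<open>?r\<close> gathers their coordinates into one function.\<close>
  let ?r = "\<lambda>z. \<Sum>m. (B m $ i) * (z - l k) ^ m"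
  have ev: "\<forall>\<^sub>F z in at (l k) within cut_plane \<eta> l. summable (\<lambda>m. (B m $ i) * (z - l k) ^ m) \<and>
      f z $ i = branch_pow \<eta> (z - l k) b * ?r z"
    using B
  proof eventually_elim
    case (elim z)
    then obtain s where s: "(\<lambda>m. (z - l k) ^ m *s B m) sums s" "f z = branch_pow \<eta> (z - l k) b *s s"
      by blast
    have "(\<lambda>m. ((z - l k) ^ m *s B m) $ i) sums (s $ i)"
      by (rule bounded_linear.sums[OF bounded_linear_vec_nth s(1)])
    then have "(\<lambda>m. (B m $ i) * (z - l k) ^ m) sums (s $ i)"
      by (simp add: mult.commute)
    then show ?case
      using s(2) by (auto simp: sums_iff)
  qed
  have "\<forall>\<^sub>F z in at (l k) within cut_plane \<eta> l. z \<noteq> l k"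
    by (simp add: eventually_at_filter)
  with ev have "\<forall>\<^sub>F z in at (l k) within cut_plane \<eta> l.
      summable (\<lambda>m. (B m $ i) * (z - l k) ^ m) \<and> z \<noteq> l k"
    by eventually_elim simp
  then obtain z1 where "summable (\<lambda>m. (B m $ i) * (z1 - l k) ^ m)" "z1 \<noteq> l k"
    using eventually_happens'[OF False] by blast
  then have "?r analytic_on {l k}"
    by (rule power_series_analytic)
  from has_monodromy_combine(2)[OF has_monodromy_pow has_monodromy_analytic[OF this]]
  have "has_monodromy \<eta> (cut_plane \<eta> l) (l k) (\<lambda>z. branch_pow \<eta> (z - l k) b * ?r z)
      (\<lambda>z. exp (2 * of_real pi * \<i> * b) * branch_pow \<eta> (z - l k) b * ?r z)" .
  then show ?thesis
    by (rule has_monodromy_cong) (use ev in \<open>eventually_elim, simp\<close>)+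
qed

text \<open>With \<open>f\<close> single valued and the remainder analytic, only the logarithm
  changes, by one period.\<close>

lemma log_form_monodromy:
  fixes l :: "'n::finite \<Rightarrow> complex" and f S :: "complex \<Rightarrow> complex^'n"
  assumes "log_form \<eta> l k f S"
    "has_monodromy \<eta> (cut_plane \<eta> l) (l k) (\<lambda>z. f z $ i) (\<lambda>z. f z $ i)"
  shows "has_monodromy \<eta> (cut_plane \<eta> l) (l k) (\<lambda>z. S z $ i)
           (\<lambda>z. S z $ i + 2 * of_real pi * \<i> * f z $ i)"
proof -
  obtain r where r: "vec_analytic_at r (l k)"
    and ev: "\<forall>\<^sub>F z in at (l k) within cut_plane \<eta> l. S z = branch_ln \<eta> (z - l k) *s f z + r z"
    using assms(1) unfolding log_form_def by blast
  have "(\<lambda>z. r z $ i) analytic_on {l k}"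
    using r by (simp add: vec_analytic_at_def)
  note has_monodromy_combine(1)[OF has_monodromy_combine(2)[OF has_monodromy_ln assms(2)]
      has_monodromy_analytic[OF this]]
  then show ?thesis
    by (rule has_monodromy_cong) (use ev in \<open>eventually_elim, simp add: algebra_simps\<close>)+
qed

text \<open>The polar part is single valued, a polynomial times an inverse power, so again only the
  logarithm contributes.\<close>

lemma log_pole_form_monodromy:
  fixes l :: "'n::finite \<Rightarrow> complex" and f S :: "complex \<Rightarrow> complex^'n"
  assumes "log_pole_form \<eta> l k N f S"
    "has_monodromy \<eta> (cut_plane \<eta> l) (l k) (\<lambda>z. f z $ i) (\<lambda>z. f z $ i)"
  shows "has_monodromy \<eta> (cut_plane \<eta> l) (l k) (\<lambda>z. S z $ i)
           (\<lambda>z. S z $ i + 2 * of_real pi * \<i> * f z $ i)"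
proof -
  obtain p r where r: "vec_analytic_at r (l k)"
    and ev: "\<forall>\<^sub>F z in at (l k) within cut_plane \<eta> l. S z = branch_ln \<eta> (z - l k) *s f z
               + (1 / (z - l k) ^ (N + 1)) *s (\<Sum>m\<le>N. (z - l k) ^ m *s p m) + r z"
    using assms(1) unfolding log_pole_form_def by blast
  have an: "(\<lambda>z. r z $ i) analytic_on {l k}"
    using r by (simp add: vec_analytic_at_def)
  have poly: "(\<lambda>z. \<Sum>m\<le>N. (z - l k) ^ m * p m $ i) analytic_on {l k}"
    by (intro analytic_intros)
  note has_monodromy_combine(1)[OF has_monodromy_combine(1)[OF
      has_monodromy_combine(2)[OF has_monodromy_ln assms(2)]
      has_monodromy_combine(2)[OF has_monodromy_inverse_power[of _ _ _ "N + 1"]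
        has_monodromy_analytic[OF poly]]]
      has_monodromy_analytic[OF an]]
  then show ?thesis
    by (rule has_monodromy_cong) (use ev in \<open>eventually_elim, simp add: algebra_simps\<close>)+
qed

section \<open>Monodromy of the solutions attached to a singular point\<close>

text \<open>For a nonintegral diagonal entry the multiplier is that of the leading power. For an
  integral one \<open>f\<close> is single valued and the stated factor equals
  \<open>1\<close>.\<close>

lemma Psi_monodromy:
  fixes l :: "'n::finite \<Rightarrow> complex" and f :: "complex \<Rightarrow> complex^'n"
  assumes "is_Psi \<eta> l A1 k f"
  shows "has_monodromy \<eta> (cut_plane \<eta> l) (l k) (\<lambda>z. f z $ i)
           (\<lambda>z. exp (- 2 * of_real pi * \<i> * A1 $ k $ k) * f z $ i)"
proof (cases "A1 $ k $ k \<in> \<int>")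
  case False
  then have "power_form \<eta> l k (Gamma (A1 $ k $ k + 1) *s axis k 1) (- (A1 $ k $ k) - 1) f"
    using assms by (simp add: is_Psi_def)
  \<comment> \<open>The extra \<open>- 1\<close> in the exponent contributes a full period.\<close>
  moreover have "exp (2 * of_real pi * \<i> * (- (A1 $ k $ k) - 1)) =
      exp (- 2 * of_real pi * \<i> * A1 $ k $ k)"
    by (simp add: algebra_simps exp_diff exp_two_pi_i)
  ultimately show ?thesis
    using power_form_monodromy by metis
next
  case True
  then obtain N where N: "A1 $ k $ k = of_int N" by (auto elim: Ints_cases)
  have e1: "exp (- 2 * of_real pi * \<i> * A1 $ k $ k) = 1"
    using exp_two_pi_i_of_int[of "- N"] N by simp
  show ?thesis
  proof (cases "N < 0")
    case True
    then have "power_form \<eta> l k (((-1) powi N / fact (nat (- N - 1))) *s axis k 1) (of_int (- N - 1)) f"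
      using assms N by (simp add: is_Psi_def)
    from power_form_monodromy[OF this] show ?thesis
      by (simp only: exp_two_pi_i_of_int e1)
  next
    case False
    then have "A1 $ k $ k = of_nat (nat N)" using N by simp
    then obtain r where r: "vec_analytic_at r (l k)"
      "\<forall>\<^sub>F z in at (l k) within cut_plane \<eta> l. f z = r z"
      using assms unfolding is_Psi_def by blast
    have "(\<lambda>z. r z $ i) analytic_on {l k}"
      using r(1) by (simp add: vec_analytic_at_def)
    then have "has_monodromy \<eta> (cut_plane \<eta> l) (l k) (\<lambda>z. r z $ i) (\<lambda>z. r z $ i)"
      by (rule has_monodromy_analytic)
    then show ?thesis
      unfolding e1 by (rule has_monodromy_cong) (use r(2) in \<open>eventually_elim, simp\<close>)+
  qed
qed

text \<open>\<open>alpha\<close> unifies two mechanisms: if \<open>S\<close> agrees with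
  \<open>f\<close>, the multiplier minus one; if \<open>S\<close> is logarithmic, the period of the
  logarithm.\<close>

lemma Psi_sing_monodromy:
  fixes l :: "'n::finite \<Rightarrow> complex" and f S :: "complex \<Rightarrow> complex^'n"
  assumes "is_Psi \<eta> l A1 k f" "is_Psi_sing \<eta> l A1 k f S"
    "\<not> (\<forall>z\<in>cut_plane \<eta> l. S z = 0)"
  shows "has_monodromy \<eta> (cut_plane \<eta> l) (l k) (\<lambda>z. S z $ i)
           (\<lambda>z. S z $ i + alpha A1 k * f z $ i)"
proof (cases "A1 $ k $ k \<in> \<int>")
  case False
  then have "\<forall>z\<in>cut_plane \<eta> l. S z = f z"
    using assms(2) by (simp add: is_Psi_sing_def)
  then have ev: "\<forall>\<^sub>F z in at (l k) within cut_plane \<eta> l. S z = f z"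
    by (auto simp: eventually_at_filter)
  show ?thesis
    by (rule has_monodromy_cong[OF Psi_monodromy[OF assms(1)]];
        use ev in eventually_elim) (use False in \<open>simp_all add: alpha_def algebra_simps\<close>)
next
  case True
  then obtain N where N: "A1 $ k $ k = of_int N" by (auto elim: Ints_cases)
  have "exp (- 2 * of_real pi * \<i> * A1 $ k $ k) = 1"
    using exp_two_pi_i_of_int[of "- N"] N by simp
  then have inv: "has_monodromy \<eta> (cut_plane \<eta> l) (l k) (\<lambda>z. f z $ i) (\<lambda>z. f z $ i)"
    using Psi_monodromy[OF assms(1), of i] by simp
  have \<alpha>: "alpha A1 k = 2 * of_real pi * \<i>"
    using True by (simp add: alpha_def)
  show ?thesis
  proof (cases "N < 0")
    case True
    \<comment> \<open>Without a logarithmic solution \<open>S\<close> would vanish on the cut plane,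
      which the third assumption excludes.\<close>
    then have "log_form \<eta> l k f S"
      using assms(2,3) N unfolding is_Psi_sing_def by meson
    then show ?thesis
      unfolding \<alpha> using inv by (rule log_form_monodromy)
  next
    case False
    then have "A1 $ k $ k = of_nat (nat N)" using N by simp
    then have "log_pole_form \<eta> l k (nat N) f S"
      using assms(2) unfolding is_Psi_sing_def by blast
    then show ?thesis
      unfolding \<alpha> using inv by (rule log_pole_form_monodromy)
  qed
qed

text \<open>Modulo a function analytic at \<open>l k\<close>, \<open>\<psi> j\<close> is
  \<open>c k j\<close> times the singular solution, so the increment of the latter is scaled by
  \<open>c k j\<close>.\<close>

lemma connection_monodromy:
  fixes \<psi> S :: "'n::finite \<Rightarrow> complex \<Rightarrow> complex^'n"
  assumes "is_Psi \<eta> l A1 k (\<psi> k)" "is_Psi_sing \<eta> l A1 k (\<psi> k) (S k)"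
    "is_connection_coeffs \<eta> l \<psi> S c"
  shows "has_monodromy \<eta> (cut_plane \<eta> l) (l k) (\<lambda>z. \<psi> j z $ i)
           (\<lambda>z. \<psi> j z $ i + alpha A1 k * c k j * \<psi> k z $ i)"
proof -
  obtain r where r: "vec_analytic_at r (l k)"
    "\<forall>\<^sub>F z in at (l k) within cut_plane \<eta> l. \<psi> j z = c k j *s S k z + r z"
    using assms(3) unfolding is_connection_coeffs_def by blast
  have "(\<lambda>z. r z $ i) analytic_on {l k}"
    using r(1) by (simp add: vec_analytic_at_def)
  then have R: "has_monodromy \<eta> (cut_plane \<eta> l) (l k) (\<lambda>z. r z $ i) (\<lambda>z. r z $ i)"
    by (rule has_monodromy_analytic)
  show ?thesis
  proof (cases "\<forall>z\<in>cut_plane \<eta> l. S k z = 0")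
    case True
    \<comment> \<open>The convention for a vanishing singular solution makes the increment zero,
      matching the analyticity of \<open>\<psi> j\<close> at \<open>l k\<close>.\<close>
    then have "c k j = 0"
      using assms(3) unfolding is_connection_coeffs_def by blast
    with r(2) have "\<forall>\<^sub>F z in at (l k) within cut_plane \<eta> l. \<psi> j z = r z"
      by simp
    then show ?thesis
      by (intro has_monodromy_cong[OF R]; eventually_elim) (simp_all add: \<open>c k j = 0\<close>)
  next
    case False
    note has_monodromy_combine(1)[OF
        has_monodromy_cmult[OF Psi_sing_monodromy[OF assms(1,2) False]] R]
    then show ?thesis
      by (rule has_monodromy_cong) (use r(2) in \<open>eventually_elim, simp add: algebra_simps\<close>)+
  qed
qed

section \<open>Choice of the radius and the matrix form\<close>

text \<open>Admissibility keeps \<open>l k\<close> off the other cuts, which are closed and finite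
  in number; hence a loop in a small ball can meet only its own cut.\<close>

lemma small_ball_avoids_cuts:
  fixes l :: "'n::finite \<Rightarrow> complex"
  assumes "inj l" "admissible \<eta> l"
  shows "\<forall>\<^sub>F \<epsilon> in at_right 0. \<forall>j. j \<noteq> k \<longrightarrow> ball (l k) \<epsilon> \<inter> cut_ray \<eta> (l j) = {}"
proof -
  have "\<forall>\<^sub>F \<epsilon> in at_right 0. ball (l k) \<epsilon> \<inter> cut_ray \<eta> (l j) = {}" if j: "j \<noteq> k" for j
  proof -
    have ne: "l k \<noteq> l j" using assms(1) j by (auto dest: injD)
    have "l k \<notin> cut_ray \<eta> (l j)"
    proof
      assume "l k \<in> cut_ray \<eta> (l j)"
      then obtain t where t: "l k - l j = of_real t * cis \<eta>" "t \<ge> 0"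
        by (auto simp: cut_ray_def)
      with ne have "t > 0" by (cases "t = 0") auto
      \<comment> \<open>Compare polar forms: a point on the ray has direction \<open>\<eta>\<close>,
        so \<open>\<eta>\<close> would be an argument of \<open>l k - l j\<close> modulo
        \<open>2 * pi\<close>.\<close>
      have "of_real t * cis (Arg (l k - l j)) = of_real t * cis \<eta>"
        using t ne \<open>t > 0\<close> rcis_cmod_Arg[of "l k - l j"] by (simp add: rcis_def norm_mult)
      then have "cis \<eta> = cis (Arg (l k - l j))"
        using \<open>t > 0\<close> by simp
      then have "sin \<eta> = sin (Arg (l k - l j)) \<and> cos \<eta> = cos (Arg (l k - l j))"
        by (auto simp: complex_eq_iff)
      then obtain m :: int where "\<eta> = Arg (l k - l j) + 2 * pi * m"
        unfolding sin_cos_eq_iff by blast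
      then show False
        using assms(2) j unfolding admissible_def by metis
    qed
    then obtain e where e: "e > 0" "ball (l k) e \<subseteq> - cut_ray \<eta> (l j)"
      using closed_cut_ray[of \<eta> "l j"] by (metis ComplI open_Compl open_contains_ball)
    have "ball (l k) \<epsilon> \<inter> cut_ray \<eta> (l j) = {}" if "\<epsilon> < e" for \<epsilon>
      using e(2) subset_ball[of \<epsilon> e "l k"] that by auto
    then show ?thesis
      unfolding eventually_at_right_field using e(1) by auto
  qed
  then show ?thesis
    by (intro eventually_all_finite) (auto simp: eventually_mono)
qed

text \<open>Column \<open>j\<close> of the monodromy matrix is supported on rows \<open>j\<close>
  and \<open>k\<close>, so the product sum collapses.\<close>

lemma matrix_mult_monodromy_matrix:
  fixes \<psi> :: "'n::finite \<Rightarrow> complex \<Rightarrow> complex^'n"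
  shows
  "(matrix_of_columns \<psi> z ** monodromy_matrix A1 c k) $ i $ j =
     (if j = k then exp (- 2 * of_real pi * \<i> * A1 $ k $ k) * \<psi> k z $ i
      else \<psi> j z $ i + alpha A1 k * c k j * \<psi> k z $ i)"
proof -
  have "(matrix_of_columns \<psi> z ** monodromy_matrix A1 c k) $ i $ j =
     (\<Sum>m\<in>UNIV. \<psi> m z $ i * monodromy_matrix A1 c k $ m $ j)"
    by (simp add: matrix_matrix_mult_def matrix_of_columns_def)
  \<comment> \<open>The guard \<open>k = j\<close> prevents counting the diagonal entry
    twice.\<close>
  also have "\<dots> = (\<Sum>m\<in>UNIV. (if m = j then \<psi> j z $ i * monodromy_matrix A1 c k $ j $ j else 0) +
      (if m = k then (if k = j then 0 else \<psi> k z $ i * (alpha A1 k * c k j)) else 0))"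
    by (intro sum.cong) (auto simp: monodromy_matrix_def)
  also have "\<dots> = \<psi> j z $ i * monodromy_matrix A1 c k $ j $ j +
      (if k = j then 0 else \<psi> k z $ i * (alpha A1 k * c k j))"
    by (simp add: sum.distrib)
  finally show ?thesis
    by (simp add: monodromy_matrix_def)
qed

theorem propositionI:
  fixes l :: "'n::finite \<Rightarrow> complex"
    and A1 :: "complex^'n^'n"
    and \<eta> :: real
    and \<psi> S :: "'n \<Rightarrow> complex \<Rightarrow> complex^'n"
    and c :: "'n \<Rightarrow> 'n \<Rightarrow> complex"
  assumes "inj l"
    and "admissible \<eta> l"
    and "\<And>k. is_Psi \<eta> l A1 k (\<psi> k)"
    and "\<And>k. is_Psi_sing \<eta> l A1 k (\<psi> k) (S k)"
    and "is_connection_coeffs \<eta> l \<psi> S c"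
  shows "\<forall>k. \<exists>\<epsilon>>0. (\<forall>j. j \<noteq> k \<longrightarrow> ball (l k) \<epsilon> \<inter> cut_ray \<eta> (l j) = {}) \<and>
    (\<forall>\<gamma>. small_loop \<eta> l k \<epsilon> \<gamma> \<longrightarrow>
       matrix_continues_along \<gamma> (matrix_of_columns \<psi>)
         (\<lambda>z. matrix_of_columns \<psi> z ** monodromy_matrix A1 c k) \<and>
       vec_continues_along \<gamma> (\<psi> k) (\<lambda>z. exp (- 2 * of_real pi * \<i> * A1 $ k $ k) *s \<psi> k z) \<and>
       (\<forall>j. j \<noteq> k \<longrightarrow>
          vec_continues_along \<gamma> (\<psi> j) (\<lambda>z. \<psi> j z + (alpha A1 k * c k j) *s \<psi> k z)))"
proof
  fix k
  let ?e = "exp (- 2 * of_real pi * \<i> * A1 $ k $ k)"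
  \<comment> \<open>Every requirement holds for all sufficiently small radii, and the indices
    \<open>i\<close> and \<open>j\<close> range over a finite type, so one radius serves them
    all.\<close>
  have "\<forall>\<^sub>F \<epsilon> in at_right (0::real). \<epsilon> > 0 \<and>
      (\<forall>j. j \<noteq> k \<longrightarrow> ball (l k) \<epsilon> \<inter> cut_ray \<eta> (l j) = {}) \<and>
      (\<forall>i. \<forall>\<gamma>. small_loop \<eta> l k \<epsilon> \<gamma> \<longrightarrow>
         continues_along \<gamma> (\<lambda>z. \<psi> k z $ i) (\<lambda>z. ?e * \<psi> k z $ i)) \<and>
      (\<forall>j i. \<forall>\<gamma>. small_loop \<eta> l k \<epsilon> \<gamma> \<longrightarrow>
         continues_along \<gamma> (\<lambda>z. \<psi> j z $ i) (\<lambda>z. \<psi> j z $ i + alpha A1 k * c k j * \<psi> k z $ i))"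
    by (intro eventually_conj eventually_at_right_less small_ball_avoids_cuts[OF assms(1,2)]
        eventually_all_finite has_monodromy_continues_along Psi_monodromy assms
        connection_monodromy[OF assms(3,4,5)])
  then obtain \<epsilon> where \<epsilon>: "\<epsilon> > 0"
      "\<forall>j. j \<noteq> k \<longrightarrow> ball (l k) \<epsilon> \<inter> cut_ray \<eta> (l j) = {}"
    and cont_k: "\<And>i \<gamma>. small_loop \<eta> l k \<epsilon> \<gamma> \<Longrightarrow>
         continues_along \<gamma> (\<lambda>z. \<psi> k z $ i) (\<lambda>z. ?e * \<psi> k z $ i)"
    and cont: "\<And>j i \<gamma>. small_loop \<eta> l k \<epsilon> \<gamma> \<Longrightarrow>
         continues_along \<gamma> (\<lambda>z. \<psi> j z $ i) (\<lambda>z. \<psi> j z $ i + alpha A1 k * c k j * \<psi> k z $ i)"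
    using eventually_happens'[OF trivial_limit_at_right_real] by blast
  have "matrix_continues_along \<gamma> (matrix_of_columns \<psi>)
         (\<lambda>z. matrix_of_columns \<psi> z ** monodromy_matrix A1 c k)" if "small_loop \<eta> l k \<epsilon> \<gamma>" for \<gamma>
    unfolding matrix_continues_along_def matrix_mult_monodromy_matrix
  proof (intro allI)
    fix i j
    show "continues_along \<gamma> (\<lambda>z. matrix_of_columns \<psi> z $ i $ j)
        (\<lambda>z. if j = k then ?e * \<psi> k z $ i else \<psi> j z $ i + alpha A1 k * c k j * \<psi> k z $ i)"
      using cont_k[OF that] cont[OF that]
      by (cases "j = k") (simp_all add: matrix_of_columns_def)
  qed
  then show "\<exists>\<epsilon>>0. (\<forall>j. j \<noteq> k \<longrightarrow> ball (l k) \<epsilon> \<inter> cut_ray \<eta> (l j) = {}) \<and>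
    (\<forall>\<gamma>. small_loop \<eta> l k \<epsilon> \<gamma> \<longrightarrow>
       matrix_continues_along \<gamma> (matrix_of_columns \<psi>)
         (\<lambda>z. matrix_of_columns \<psi> z ** monodromy_matrix A1 c k) \<and>
       vec_continues_along \<gamma> (\<psi> k) (\<lambda>z. ?e *s \<psi> k z) \<and>
       (\<forall>j. j \<noteq> k \<longrightarrow>
          vec_continues_along \<gamma> (\<psi> j) (\<lambda>z. \<psi> j z + (alpha A1 k * c k j) *s \<psi> k z)))"
    using \<epsilon> cont_k cont by (intro exI[of _ \<epsilon>]) (auto simp: vec_continues_along_def)
qed

end
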